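(* For any real number $r$ with $0 \leq r \leq 1$, there exists an infinite strictly increasing sequence of positive integers $s_1 < s_2 < s_3 < \cdots$ such that, writing $S_k = \{s_1, s_2, \ldots, s_k\}$ for the set of its first $k$ elements, $\mathrm{CM}(S_k)/k$ tends to $r$ as $k$ tends to infinity.
   Context: A finite set $S$ of distinct positive integers is regarded as a set of jars, the jar corresponding to $s \in S$ initially containing $s$ cookies. On a move, the Cookie Monster chooses a subset of the jars and a positive integer $a$ and removes exactly $a$ cookies from each jar of the chosen subset (each chosen jar must contain at least $a$ cookies at that time). The Cookie Monster number $\mathrm{CM}(S)$ is the minimum number of moves needed to empty all of the jars. *)

theory Defs
  imports Complex_Main
begin

text \<open>A configuration \<open>c\<close> maps the label \<open>s\<close> of a jar to its current number of cookies. Since the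
  jar labelled \<open>s\<close> starts with \<open>s\<close> cookies, the initial configuration is the identity. Values of
  \<open>c\<close> outside the set \<open>S\<close> of jars are irrelevant and never change.\<close>

definition cookie_move :: "nat set \<Rightarrow> (nat \<Rightarrow> nat) \<Rightarrow> (nat \<Rightarrow> nat) \<Rightarrow> bool" where
  "cookie_move S c c' \<longleftrightarrow>
     (\<exists>A a. A \<subseteq> S \<and> 0 < a \<and> (\<forall>s\<in>A. a \<le> c s) \<and> c' = (\<lambda>s. if s \<in> A then c s - a else c s))"

definition emptied_in :: "nat set \<Rightarrow> nat \<Rightarrow> bool" where
  "emptied_in S n \<longleftrightarrow> (\<exists>c. (cookie_move S ^^ n) (\<lambda>s. s) c \<and> (\<forall>s\<in>S. c s = 0))"

definition CM :: "nat set \<Rightarrow> nat" where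
  "CM S = (LEAST n. emptied_in S n)"

text \<open>The minimum in the definition of \<open>CM\<close> is attained: emptying one jar at a time works.\<close>

lemma emptied_in_exists:
  assumes "finite S"
  shows "\<exists>n. emptied_in S n"
proof -
  have "\<exists>n. (cookie_move S ^^ n) (\<lambda>s. s) (\<lambda>s. if s \<in> T then 0 else s)"
    if "finite T" "T \<subseteq> S" for T
    using that
  proof (induction T rule: finite_induct)
    case empty
    have "(cookie_move S ^^ 0) (\<lambda>s. s) (\<lambda>s. if s \<in> {} then 0 else s)"
      by simp
    then show ?case by blast
  next
    case (insert x T)
    let ?c = "\<lambda>s. if s \<in> T then 0 else s"
    let ?d = "\<lambda>s. if s \<in> insert x T then 0 else s"
    obtain n where n: "(cookie_move S ^^ n) (\<lambda>s. s) ?c"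
      using insert by auto
    show ?case
    proof (cases "x = 0")
      case True
      then have "?d = ?c" by auto
      then show ?thesis using n by metis
    next
      case False
      have "cookie_move S ?c ?d"
        unfolding cookie_move_def
        by (rule exI[of _ "{x}"], rule exI[of _ x]) (use False insert in auto)
      then have "(cookie_move S ^^ Suc n) (\<lambda>s. s) ?d"
        using n by auto
      then show ?thesis by blast
    qed
  qed
  from this[of S] assms show ?thesis
    unfolding emptied_in_def by fastforce
qed

lemma emptied_in_CM: "finite S \<Longrightarrow> emptied_in S (CM S)"
  unfolding CM_def by (metis LeastI emptied_in_exists)

end

theory Submission
  imports Defs "HOL-Library.Log_Nat" "HOL-Real_Asymp.Real_Asymp"
begin

text \<open>If \<open>S\<close> contains all powers of two up to its maximum, then \<open>CM S\<close> is their number: removing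
  binary digits gives the upper bound, and the powers of two are superincreasing, so each of them
  needs a move that none of the smaller ones uses. Passing to the next power of two thus raises
  \<open>CM\<close> by one, while passing to the successor mostly leaves it unchanged; choosing greedily between
  the two keeps \<open>CM S\<^sub>k\<close> between \<open>r k\<close> and \<open>r k + 1 + log 2 k\<close>.\<close>

text \<open>Bookkeeping of the moves: \<open>A i\<close> is the set of jars chosen in move
  \<open>i\<close> and \<open>a i\<close> the amount removed. Hence every jar that ends empty
  started with a subset sum of at most \<open>n\<close> amounts.\<close>

lemma cookie_moves_subset_sum:
  assumes "(cookie_move S ^^ n) c c'"
  shows "\<exists>A a. \<forall>s. c s = c' s + (\<Sum>i | i < n \<and> s \<in> A i. a i)"
  using assms
proof (induction n arbitrary: c')
  case 0
  then show ?case by simp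
next
  case (Suc n)
  then obtain d where d: "(cookie_move S ^^ n) c d" "cookie_move S d c'"
    by auto
  obtain A a where Aa: "\<forall>s. c s = d s + (\<Sum>i | i < n \<and> s \<in> A i. a i)"
    using Suc.IH[OF d(1)] by blast
  obtain B b where B: "\<forall>s\<in>B. b \<le> d s" "c' = (\<lambda>s. if s \<in> B then d s - b else d s)"
    using d(2) unfolding cookie_move_def by blast
  have "c s = c' s + (\<Sum>i | i < Suc n \<and> s \<in> (A(n := B)) i. (a(n := b)) i)" for s
  proof -
    have "(\<Sum>i | i < n \<and> s \<in> A i. a i) = (\<Sum>i | i < n \<and> s \<in> A i. (a(n := b)) i)"
      by (rule sum.cong) auto
    moreover have "{i. i < Suc n \<and> s \<in> (A(n := B)) i} =
        (if s \<in> B then insert n else id) {i. i < n \<and> s \<in> A i}"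
      by (auto simp: less_Suc_eq)
    ultimately show ?thesis
      using Aa B by simp
  qed
  then show ?case by blast
qed

text \<open>The indices used for the smaller values have total weight below \<open>f m\<close>, so
  \<open>J m\<close> needs an index outside their union \<open>K\<close>. The induction leaves
  \<open>I\<close> arbitrary so that its hypothesis can be applied to \<open>K\<close>.\<close>

lemma card_ge_of_superincreasing_subset_sums:
  fixes f a :: "nat \<Rightarrow> nat"
  assumes "\<forall>j<m. (\<Sum>i<j. f i) < f j"
    and "finite I" and "\<forall>j<m. J j \<subseteq> I \<and> sum a (J j) = f j"
  shows "m \<le> card I"
  using assms
proof (induction m arbitrary: I)
  case 0
  then show ?case by simp
next
  case (Suc m)
  define K where "K = (\<Union>j<m. J j)"
  have sub: "K \<subseteq> I"
    unfolding K_def using Suc.prems(3) by (intro UN_least) simp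
  then have fin: "finite K"
    using Suc.prems(2) by (rule finite_subset)
  have finJ: "finite (J j)" if "j < m" for j
    using that Suc.prems finite_subset[of "J j" I] by simp
  \<comment> \<open>The sets \<open>J j\<close> may overlap. The right side counts an index once for
    each \<open>J j\<close> containing it, and \<open>snd\<close> maps the pairs onto
    \<open>K\<close>.\<close>
  have "sum a K \<le> sum (a \<circ> snd) (Sigma {..<m} J)"
    using fin finJ by (intro sum_le_included[where i = snd]) (auto simp: K_def)
  also have "\<dots> = (\<Sum>j<m. sum a (J j))"
    using finJ by (simp add: sum.Sigma split_beta)
  also have "\<dots> < f m"
    using Suc.prems by simp
  also have "\<dots> = sum a (J m)"
    using Suc.prems by simp
  finally have "\<not> J m \<subseteq> K"
    using sum_mono2[OF fin, of "J m" a] by auto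
  then have "K \<subset> I"
    using sub Suc.prems(3) by blast
  then have "card K < card I"
    using Suc.prems(2) by (simp add: psubset_card_mono)
  moreover have "m \<le> card K"
    by (rule Suc.IH) (use Suc.prems fin in \<open>auto simp: K_def\<close>)
  ultimately show ?case by simp
qed

lemma superincreasing_le_CM:
  assumes "\<forall>j<m. (\<Sum>i<j. f i) < f j" and "f ` {..<m} \<subseteq> S" and "finite S"
  shows "m \<le> CM S"
proof -
  obtain c where c: "(cookie_move S ^^ CM S) (\<lambda>s. s) c" "\<forall>s\<in>S. c s = 0"
    using emptied_in_CM[OF \<open>finite S\<close>] unfolding emptied_in_def by blast
  obtain A a where Aa: "\<forall>s. s = c s + (\<Sum>i | i < CM S \<and> s \<in> A i. a i)"
    using cookie_moves_subset_sum[OF c(1)] by blast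
  have "m \<le> card {..<CM S}"
  proof (rule card_ge_of_superincreasing_subset_sums[where J = "\<lambda>j. {i. i < CM S \<and> f j \<in> A i}"])
    show "\<forall>j<m. {i. i < CM S \<and> f j \<in> A i} \<subseteq> {..<CM S} \<and>
        sum a {i. i < CM S \<and> f j \<in> A i} = f j"
    proof (intro allI impI conjI)
      fix j assume "j < m"
      then have "c (f j) = 0"
        using c(2) assms(2) by auto
      then show "sum a {i. i < CM S \<and> f j \<in> A i} = f j"
        using Aa by (metis add_0)
    qed auto
  qed (use assms in auto)
  then show ?thesis by simp
qed

text \<open>Move \<open>i\<close> takes \<open>2 ^ i\<close> from exactly those jars whose binary
  digit at position \<open>i\<close> is 1.\<close>

lemma CM_le_of_less_power:
  assumes "\<forall>s\<in>S. s < 2 ^ n"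
  shows "CM S \<le> n"
proof -
  \<comment> \<open>The state after \<open>n\<close> moves: the lowest \<open>n\<close> binary
    digits are cleared. Labels outside \<open>S\<close> keep their value, as no move touches
    them.\<close>
  let ?c = "\<lambda>n s. if s \<in> S then 2 ^ n * (s div 2 ^ n) else s"
  have "(cookie_move S ^^ n) (\<lambda>s. s) (?c n)" for n
  proof (induction n)
    case 0
    then show ?case by (simp add: fun_eq_iff)
  next
    case (Suc n)
    have split: "s div 2 ^ n = 2 * (s div 2 ^ Suc n) + s div 2 ^ n mod 2" for s :: nat
      by (metis div_mult2_eq mult_div_mod_eq power_Suc2)
    have step: "2 ^ n * (s div 2 ^ n) = 2 ^ Suc n * (s div 2 ^ Suc n) +
        (if odd (s div 2 ^ n) then 2 ^ n else 0)" for s :: nat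
      by (subst split) (auto simp: algebra_simps odd_iff_mod_2_eq_one even_iff_mod_2_eq_zero)
    have "cookie_move S (?c n) (?c (Suc n))"
      unfolding cookie_move_def
      by (rule exI[of _ "{s \<in> S. odd (s div 2 ^ n)}"], rule exI[of _ "2 ^ n"])
        (use step in \<open>auto simp: fun_eq_iff\<close>)
    then show ?case using Suc by auto
  qed
  from this[of n] have "emptied_in S n"
    unfolding emptied_in_def using assms by (intro exI[of _ "?c n"]) auto
  then show ?thesis
    unfolding CM_def by (rule Least_le)
qed

lemma CM_eq_of_powers:
  assumes "\<And>s. s \<in> S \<Longrightarrow> s < 2 ^ n" and "\<And>i. i < n \<Longrightarrow> 2 ^ i \<in> S"
  shows "CM S = n"
proof (rule antisym)
  show "CM S \<le> n"
    using assms(1) by (simp add: CM_le_of_less_power)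
  have "finite S"
    using assms(1) by (intro finite_subset[of S "{..<2 ^ n}"]) auto
  moreover have "(\<Sum>i<j. 2 ^ i) < (2 ^ j :: nat)" for j
    by (induction j) auto
  ultimately show "n \<le> CM S"
    using assms(2) by (intro superincreasing_le_CM[where f = "\<lambda>i. 2 ^ i"]) auto
qed

text \<open>Indices start at 0, so the new prefix has \<open>k + 2\<close> elements.
  \<open>floorlog 2\<close> counts binary digits and will turn out to be \<open>CM\<close> of the
  current prefix. The successor is chosen if this count already suffices for the longer prefix;
  otherwise the least power of two above the last element is added.\<close>

primrec greedy :: "real \<Rightarrow> nat \<Rightarrow> nat" where
  "greedy r 0 = 1"
| "greedy r (Suc k) =
     (if r * (k + 2) \<le> floorlog 2 (greedy r k) then Suc (greedy r k)
      else 2 ^ floorlog 2 (greedy r k))"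

lemma floorlog2_bounds:
  assumes "0 < x"
  shows "2 ^ (floorlog 2 x - 1) \<le> x" "x < 2 ^ floorlog 2 x" "0 < floorlog 2 x"
  using floorlog_bounds[of x 2] assms by (auto simp: floorlog_def)

lemma floorlog2_power: "floorlog 2 (2 ^ n) = Suc n"
  using floorlog_power[of 1 2 n] by (simp add: floorlog_def del: floorlog_power)

lemma greedy_pos: "0 < greedy r k"
  by (induction k) auto

lemma greedy_strict_mono: "strict_mono (greedy r)"
  using floorlog2_bounds(2)[OF greedy_pos] by (auto simp: strict_mono_Suc_iff)

text \<open>No step jumps over a power of two, since it goes at most to the next one.\<close>

lemma power_in_greedy:
  "i < floorlog 2 (greedy r k) \<Longrightarrow> 2 ^ i \<in> greedy r ` {..k}"
proof (induction k)
  case 0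
  then show ?case by (simp add: floorlog_def)
next
  case (Suc k)
  let ?n = "floorlog 2 (greedy r k)"
  show ?case
  proof (cases "i < ?n")
    case True
    then show ?thesis using Suc.IH by auto
  next
    case False
    \<comment> \<open>A digit position that is new in this step squeezes the new element to
      \<open>2 ^ i\<close>. This includes successor steps that arrive at a power of two.\<close>
    have "greedy r (Suc k) \<le> 2 ^ ?n"
      using floorlog2_bounds(2)[OF greedy_pos, of r k] by auto
    moreover have "(2::nat) ^ ?n \<le> 2 ^ i"
      using False by simp
    moreover have "(2::nat) ^ i \<le> 2 ^ (floorlog 2 (greedy r (Suc k)) - 1)"
      using Suc.prems by (intro power_increasing) auto
    moreover have "\<dots> \<le> greedy r (Suc k)"
      by (rule floorlog2_bounds(1)[OF greedy_pos])
    ultimately have "2 ^ i = greedy r (Suc k)"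
      by linarith
    then show ?thesis by (metis atMost_iff imageI order_refl)
  qed
qed

lemma CM_greedy: "CM (greedy r ` {..k}) = floorlog 2 (greedy r k)"
proof (rule CM_eq_of_powers)
  fix s assume "s \<in> greedy r ` {..k}"
  then have "s \<le> greedy r k"
    using strict_mono_less_eq[OF greedy_strict_mono] by auto
  also have "\<dots> < 2 ^ floorlog 2 (greedy r k)"
    by (rule floorlog2_bounds(2)[OF greedy_pos])
  finally show "s < 2 ^ floorlog 2 (greedy r k)" .
qed (rule power_in_greedy)

text \<open>A successor step is taken only when the bound for the new index already holds. Any other
  step adds one digit, which is enough because \<open>r\<close> is at most 1.\<close>

lemma floorlog_greedy_ge:
  fixes r :: real
  assumes "0 \<le> r" "r \<le> 1"
  shows "r * (k + 1) \<le> floorlog 2 (greedy r k)"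
proof (induction k)
  case 0
  then show ?case using assms by (simp add: floorlog_def)
next
  case (Suc k)
  have "floorlog 2 (greedy r k) \<le> floorlog 2 (Suc (greedy r k))"
    by (rule floorlog_mono) simp
  then show ?case
    using Suc assms by (auto simp: floorlog2_power algebra_simps)
qed

text \<open>Successor steps can also gain a digit, so the induction bounds the element itself
  instead of its digit count. Each successor adds 1, absorbed by the factor \<open>k + 1\<close>; a
  power step resets to a value below \<open>2 powr (r * (k + 2))\<close>. Taking logarithms turns
  the factor into the term \<open>log 2 (k + 1)\<close>.\<close>

lemma greedy_le:
  assumes "0 \<le> r"
  shows "greedy r k \<le> (k + 1) * 2 powr (r * (k + 1))"
proof (induction k)
  case 0
  then show ?case using assms by (simp add: ge_one_powr_ge_zero)
next
  case (Suc k)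
  let ?n = "floorlog 2 (greedy r k)"
  define p where "p = 2 powr (r * (Suc k + 1))"
  have p: "1 \<le> p"
    unfolding p_def using assms by (intro ge_one_powr_ge_zero) auto
  have "greedy r (Suc k) \<le> (Suc k + 1) * p"
  proof (cases "r * (k + 2) \<le> ?n")
    case True
    have "(2::real) powr (r * (k + 1)) \<le> p"
      unfolding p_def using assms by (intro powr_mono mult_left_mono) auto
    then have "(k + 1) * (2::real) powr (r * (k + 1)) \<le> (k + 1) * p"
      by (intro mult_left_mono) auto
    then show ?thesis
      using True Suc p by (simp add: algebra_simps)
  next
    case False
    have "real (2 ^ ?n) = 2 powr ?n"
      by (simp add: powr_realpow)
    also have "\<dots> \<le> p"
      unfolding p_def using False by (intro powr_mono) auto
    also have "\<dots> \<le> (Suc k + 1) * p"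
      using p mult_right_mono[of 1 "real (Suc k + 1)" p] by simp
    finally show ?thesis using False by simp
  qed
  then show ?case unfolding p_def by simp
qed

lemma floorlog_greedy_le:
  assumes "0 \<le> r"
  shows "floorlog 2 (greedy r k) \<le> r * (k + 1) + 1 + log 2 (k + 1)"
proof -
  have pos: "0 < real (greedy r k)"
    using greedy_pos by simp
  have "floorlog 2 (greedy r k) \<le> log 2 (greedy r k) + 1"
    using greedy_pos[of r k] by (simp add: floorlog_def)
  also have "log 2 (greedy r k) \<le> log 2 ((k + 1) * 2 powr (r * (k + 1)))"
    using greedy_le[OF assms, of k] pos by (subst log_le_cancel_iff) (auto simp: add.commute)
  also have "\<dots> = log 2 (k + 1) + r * (k + 1)"
    by (simp add: log_mult)
  finally show ?thesis by (simp add: add_ac)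
qed

theorem theorem20:
  fixes r :: real
  assumes "0 \<le> r" and "r \<le> 1"
  shows "\<exists>s :: nat \<Rightarrow> nat. strict_mono s \<and> (\<forall>i. 0 < s i) \<and>
           (\<lambda>k. real (CM (s ` {..<k})) / real k) \<longlonglongrightarrow> r"
proof (intro exI conjI allI)
  show "strict_mono (greedy r)"
    by (rule greedy_strict_mono)
  show "0 < greedy r i" for i
    by (rule greedy_pos)
  \<comment> \<open>Only nonempty prefixes are estimated, so the divisor is positive; the shift by
    one does not affect the limit.\<close>
  have bounds: "r \<le> CM (greedy r ` {..<Suc k}) / Suc k"
    "CM (greedy r ` {..<Suc k}) / Suc k \<le> r + (1 + log 2 (Suc k)) / Suc k" for k
  proof -
    have *: "CM (greedy r ` {..<Suc k}) = floorlog 2 (greedy r k)"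
      by (simp add: CM_greedy lessThan_Suc_atMost)
    show "r \<le> CM (greedy r ` {..<Suc k}) / Suc k"
      unfolding * using floorlog_greedy_ge[OF assms, of k] by (simp add: pos_le_divide_eq add.commute)
    have "floorlog 2 (greedy r k) / Suc k \<le> (r * Suc k + (1 + log 2 (Suc k))) / Suc k"
      using floorlog_greedy_le[OF assms(1), of k] by (intro divide_right_mono) (simp_all add: add_ac)
    then show "CM (greedy r ` {..<Suc k}) / Suc k \<le> r + (1 + log 2 (Suc k)) / Suc k"
      unfolding * by (simp add: add_divide_distrib)
  qed
  have lim: "(\<lambda>k. r + (1 + log 2 (real (Suc k))) / real (Suc k)) \<longlonglongrightarrow> r"
    by real_asymp
  have "(\<lambda>k. real (CM (greedy r ` {..<Suc k})) / real (Suc k)) \<longlonglongrightarrow> r"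
    by (rule tendsto_sandwich[OF _ _ tendsto_const lim]) (use bounds in auto)
  then show "(\<lambda>k. real (CM (greedy r ` {..<k})) / real k) \<longlonglongrightarrow> r"
    by (rule LIMSEQ_imp_Suc)
qed

end
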